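(* Let $[0,T]$ be partitioned into disjoint bins $I_1,\dots,I_B$ with widths $\Delta_b=|I_b|>0$ and representative times $t_b\in I_b$. Assume the model is well-specified (Assumption A in the context) and satisfies binned orthogonality of time features (Assumption B in the context), and let $H_b,\Gamma_b$ be the bin-conditioned curvature and noise operators defined in the context. Define the bin difficulties $$\alpha_b:=\dot{\mathrm{SNR}}(t_b)\,\mathrm{Tr}\bigl(H_b^{-1}\Gamma_b\bigr)\,\Delta_b,\qquad b=1,\dots,B,$$ and assume $\alpha_b>0$ for all $b$. Then the ELBO-weighted bin objective $$\sum_{b=1}^B\frac{\alpha_b}{\mu_b}\qquad\text{subject to}\qquad \mu_b>0\ (b=1,\dots,B),\quad \sum_{b=1}^B\mu_b=1,$$ has the unique minimizer $$\mu_b^*=\frac{\sqrt{\alpha_b}}{\sum_{j=1}^B\sqrt{\alpha_j}},\qquad b=1,\dots,B.$$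
   Context: Setting. $x_0$ is a random vector in $\mathbb{R}^d$ (the data), and for $t\in[0,T]$ the noisy vector is $x_t=x_0+\sigma(t)z$ with $z\sim\mathcal{N}(0,I_d)$ independent of $x_0$; $\dot{\mathrm{SNR}}(t):=\dot\sigma(t)/\sigma^3(t)$. A denoiser $s_\theta(x,t)\in\mathbb{R}^d$ has a parameter $\theta\in\mathbb{R}^p$. Assumption A (well-specified model). There is a unique $\theta^\star\in\mathbb{R}^p$ with $s_{\theta^\star}(x_t,t)=\mathbb{E}[x_0\mid x_t]$ for all $t\in[0,T]$ simultaneously; in particular $\theta^\star$ does not depend on the time-sampling measure. Define $J_t(x):=\partial_\theta s_\theta(x,t)|_{\theta=\theta^\star}\in\mathbb{R}^{d\times p}$, $G_t(x):=J_t(x)^\top J_t(x)$, and $\Sigma_t(x):=\mathrm{Var}(x_0-\mathbb{E}[x_0\mid x_t]\mid x_t=x)$. Assumption B (binned orthogonality of time features). There are orthogonal projectors $\Pi_1,\dots,\Pi_B\in\mathbb{R}^{p\times p}$ with $\Pi_b\Pi_{b'}=0$ for $b\ne b'$, $\mathbb{R}^p=\bigoplus_{b=1}^B\mathrm{Im}(\Pi_b)$, and $J_t(x)=J_t(x)\Pi_b$ for all $t\in I_b$ and all $x$. Bin-conditioned operators. With $t$ random, distributed according to the time-sampling distribution conditioned on $I_b$, and $x_t$ the corresponding noisy vector, $$H_b:=\mathbb{E}\bigl[G_t(x_t)\mid t\in I_b\bigr],\qquad \Gamma_b:=\mathbb{E}\bigl[J_t(x_t)^\top\Sigma_t(x_t)J_t(x_t)\mid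 t\in I_b\bigr].$$ Both act within $\mathrm{Im}(\Pi_b)$; $H_b$ is assumed nondegenerate on $\mathrm{Im}(\Pi_b)$, and $H_b^{-1}$ denotes its inverse as an operator on $\mathrm{Im}(\Pi_b)$. The numbers $\alpha_b$ are regarded as fixed while the bin masses $\mu_b$ (the sampling probabilities of the bins) vary. *)

theory Defs
  imports "HOL-Probability.Probability"
begin

section \<open>Noisy data and conditional moments\<close>

definition std_normal_vec_density :: "real^'d \<Rightarrow> real" where
  "std_normal_vec_density x = (\<Prod>i\<in>UNIV. std_normal_density (x $ i))"

definition noisy ::
  "('a \<Rightarrow> real^'d) \<Rightarrow> ('a \<Rightarrow> real^'d) \<Rightarrow> (real \<Rightarrow> real) \<Rightarrow> real \<Rightarrow> 'a \<Rightarrow> real^'d" where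
  "noisy x0 z \<sigma> t \<omega> = x0 \<omega> + \<sigma> t *\<^sub>R z \<omega>"

text \<open>At the endpoints of the time interval the derivative is one-sided.\<close>

definition snr_rate :: "real \<Rightarrow> (real \<Rightarrow> real) \<Rightarrow> real \<Rightarrow> real" where
  "snr_rate T \<sigma> t = vector_derivative \<sigma> (at t within {0..T}) / \<sigma> t ^ 3"

text \<open>\<open>cond_mean M X Y\<close> is \<open>E[Y | X]\<close> and \<open>cond_var M X Y\<close> is the conditional covariance
  matrix \<open>Var(Y | X)\<close>, both as random variables on the sample space, taken entrywise
  with respect to the sigma-algebra generated by \<open>X\<close>.\<close>

definition cond_mean ::
  "'a measure \<Rightarrow> ('a \<Rightarrow> real^'d) \<Rightarrow> ('a \<Rightarrow> real^'n) \<Rightarrow> 'a \<Rightarrow> real^'n" where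
  "cond_mean M X Y \<omega> =
     (\<chi> i. real_cond_exp M (vimage_algebra (space M) X borel) (\<lambda>\<omega>'. Y \<omega>' $ i) \<omega>)"

definition cond_var ::
  "'a measure \<Rightarrow> ('a \<Rightarrow> real^'d) \<Rightarrow> ('a \<Rightarrow> real^'n) \<Rightarrow> 'a \<Rightarrow> real^'n^'n" where
  "cond_var M X Y \<omega> =
     (\<chi> i j. real_cond_exp M (vimage_algebra (space M) X borel)
        (\<lambda>\<omega>'. (Y \<omega>' - cond_mean M X Y \<omega>') $ i * (Y \<omega>' - cond_mean M X Y \<omega>') $ j) \<omega>)"

text \<open>A function \<open>x \<mapsto> Var(Y | X = x)\<close> is determined only up to null sets of the law of \<open>X\<close>;
  the predicate says that \<open>V\<close> is a version of it.\<close>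

definition cond_var_version ::
  "'a measure \<Rightarrow> ('a \<Rightarrow> real^'d) \<Rightarrow> ('a \<Rightarrow> real^'n) \<Rightarrow> (real^'d \<Rightarrow> real^'n^'n) \<Rightarrow> bool" where
  "cond_var_version M X Y V \<longleftrightarrow>
     V \<in> borel_measurable borel \<and> (AE \<omega> in M. V (X \<omega>) = cond_var M X Y \<omega>)"

section \<open>The denoiser\<close>

definition denoises ::
  "'a measure \<Rightarrow> ('a \<Rightarrow> real^'d) \<Rightarrow> ('a \<Rightarrow> real^'d) \<Rightarrow> (real \<Rightarrow> real) \<Rightarrow> real \<Rightarrow>
   (real^'p \<Rightarrow> real^'d \<Rightarrow> real \<Rightarrow> real^'d) \<Rightarrow> real^'p \<Rightarrow> bool" where
  "denoises M x0 z \<sigma> T s \<theta> \<longleftrightarrow>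
     (\<forall>t\<in>{0..T}. AE \<omega> in M. s \<theta> (noisy x0 z \<sigma> t \<omega>) t = cond_mean M (noisy x0 z \<sigma> t) x0 \<omega>)"

definition param_jac ::
  "(real^'p \<Rightarrow> real^'d \<Rightarrow> real \<Rightarrow> real^'d) \<Rightarrow> real^'p \<Rightarrow> real \<Rightarrow> real^'d \<Rightarrow> real^'p^'d" where
  "param_jac s \<theta> t x = jacobian (\<lambda>\<theta>'. s \<theta>' x t) (at \<theta>)"

definition param_gram ::
  "(real^'p \<Rightarrow> real^'d \<Rightarrow> real \<Rightarrow> real^'d) \<Rightarrow> real^'p \<Rightarrow> real \<Rightarrow> real^'d \<Rightarrow> real^'p^'p" where
  "param_gram s \<theta> t x = transpose (param_jac s \<theta> t x) ** param_jac s \<theta> t x"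

definition noise_gram ::
  "(real^'p \<Rightarrow> real^'d \<Rightarrow> real \<Rightarrow> real^'d) \<Rightarrow> real^'p \<Rightarrow> (real \<Rightarrow> real^'d \<Rightarrow> real^'d^'d) \<Rightarrow>
   real \<Rightarrow> real^'d \<Rightarrow> real^'p^'p" where
  "noise_gram s \<theta> V t x =
     transpose (param_jac s \<theta> t x) ** V t x ** param_jac s \<theta> t x"

section \<open>Binned orthogonality and bin-conditioned operators\<close>

definition orthogonal_projector :: "real^'p^'p \<Rightarrow> bool" where
  "orthogonal_projector P \<longleftrightarrow> P ** P = P \<and> transpose P = P"

definition im :: "real^'p^'p \<Rightarrow> (real^'p) set" where
  "im A = range (\<lambda>v. A *v v)"

definition binned_orthogonality ::
  "('b::finite \<Rightarrow> real set) \<Rightarrow> (real \<Rightarrow> real^'d \<Rightarrow> real^'p^'d) \<Rightarrow>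
   ('b \<Rightarrow> real^'p^'p) \<Rightarrow> bool" where
  "binned_orthogonality I J P \<longleftrightarrow>
     (\<forall>b. orthogonal_projector (P b)) \<and>
     (\<forall>b b'. b \<noteq> b' \<longrightarrow> P b ** P b' = 0) \<and>
     (\<forall>v. \<exists>!w. (\<forall>b. w b \<in> im (P b)) \<and> v = (\<Sum>b\<in>UNIV. w b)) \<and>
     (\<forall>b. \<forall>t \<in> I b. \<forall>x. J t x = J t x ** P b)"

text \<open>The conditional law of the random time given a bin \<open>A\<close>, together with an independent
  sample of the data and the Gaussian noise.\<close>

definition bin_sampling :: "real measure \<Rightarrow> real set \<Rightarrow> 'a measure \<Rightarrow> (real \<times> 'a) measure" where
  "bin_sampling \<tau> A M = uniform_measure \<tau> A \<Otimes>\<^sub>M M"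

definition nondegenerate_on :: "(real^'p) set \<Rightarrow> real^'p^'p \<Rightarrow> bool" where
  "nondegenerate_on W A \<longleftrightarrow> (\<forall>v\<in>W. A *v v = 0 \<longrightarrow> v = 0)"

text \<open>The inverse of \<open>A\<close> as an operator on \<open>im P\<close>, extended by zero to the orthogonal
  complement of \<open>im P\<close>. As \<open>\<Gamma>\<close> maps into \<open>im P\<close>, the matrix \<open>inverse_on P A ** \<Gamma>\<close> represents
  the composition of the two operators, and its trace is the trace of that
  composition on \<open>im P\<close>.\<close>

definition inverse_on :: "real^'p^'p \<Rightarrow> real^'p^'p \<Rightarrow> real^'p^'p" where
  "inverse_on P A = matrix (\<lambda>v. the_inv_into (im P) (\<lambda>u. A *v u) (P *v v))"

section \<open>The objective\<close>

definition bin_objective :: "('b::finite \<Rightarrow> real) \<Rightarrow> ('b \<Rightarrow> real) \<Rightarrow> real" where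
  "bin_objective \<alpha> \<mu> = (\<Sum>b\<in>UNIV. \<alpha> b / \<mu> b)"

definition bin_masses :: "('b::finite \<Rightarrow> real) \<Rightarrow> bool" where
  "bin_masses \<mu> \<longleftrightarrow> (\<forall>b. \<mu> b > 0) \<and> (\<Sum>b\<in>UNIV. \<mu> b) = 1"

end

theory Submission
  imports Defs
begin

text \<open>With \<open>S = (\<Sum>b. sqrt (\<alpha> b))\<close>, completing the square in each bin gives
  \<open>\<alpha> b / \<mu> b = 2 * S * sqrt (\<alpha> b) - S\<^sup>2 * \<mu> b + (sqrt (\<alpha> b) - S * \<mu> b)\<^sup>2 / \<mu> b\<close>.
  The first two terms sum to the constant \<open>S\<^sup>2\<close> when the masses sum to one, and the
  remainder is nonnegative and vanishes only at \<open>\<mu> b = sqrt (\<alpha> b) / S\<close>.\<close>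

lemma bin_objective_eq:
  fixes \<alpha> \<mu> :: "'b::finite \<Rightarrow> real"
  defines "S \<equiv> \<Sum>b\<in>UNIV. sqrt (\<alpha> b)"
  assumes \<alpha>: "\<And>b. \<alpha> b \<ge> 0" and \<mu>: "bin_masses \<mu>"
  shows "bin_objective \<alpha> \<mu> = S\<^sup>2 + (\<Sum>b\<in>UNIV. (sqrt (\<alpha> b) - S * \<mu> b)\<^sup>2 / \<mu> b)"
proof -
  have "\<alpha> b / \<mu> b = 2 * S * sqrt (\<alpha> b) - S\<^sup>2 * \<mu> b + (sqrt (\<alpha> b) - S * \<mu> b)\<^sup>2 / \<mu> b" for b
  proof -
    have "\<mu> b > 0"
      using \<mu> by (simp add: bin_masses_def)
    moreover have "\<alpha> b = (sqrt (\<alpha> b))\<^sup>2"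
      using \<alpha> by simp
    ultimately show ?thesis
      \<comment> \<open>The deleted rule would turn products
        \<open>sqrt (\<alpha> b) * sqrt (\<alpha> b)\<close> into absolute values.\<close>
      by (simp add: field_simps power2_eq_square del: real_sqrt_mult_self)
  qed
  then have "bin_objective \<alpha> \<mu> = 2 * S * (\<Sum>b\<in>UNIV. sqrt (\<alpha> b)) - S\<^sup>2 * (\<Sum>b\<in>UNIV. \<mu> b)
      + (\<Sum>b\<in>UNIV. (sqrt (\<alpha> b) - S * \<mu> b)\<^sup>2 / \<mu> b)"
    by (simp add: bin_objective_def sum.distrib sum_subtractf sum_distrib_left)
  also have "(\<Sum>b\<in>UNIV. \<mu> b) = 1"
    using \<mu> by (simp add: bin_masses_def)
  finally show ?thesis
    by (simp add: S_def power2_eq_square)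
qed

text \<open>The equivalence gives existence and uniqueness at once: the remainder in
  \<open>bin_objective_eq\<close> measures the excess over the minimum.\<close>

lemma is_arg_min_bin_objective_iff:
  fixes \<alpha> :: "'b::finite \<Rightarrow> real"
  assumes \<alpha>: "\<And>b. \<alpha> b > 0"
  shows "is_arg_min (bin_objective \<alpha>) bin_masses \<mu> \<longleftrightarrow>
    \<mu> = (\<lambda>b. sqrt (\<alpha> b) / (\<Sum>j\<in>UNIV. sqrt (\<alpha> j)))"
proof -
  define S where "S = (\<Sum>b\<in>UNIV. sqrt (\<alpha> b))"
  define m where "m = (\<lambda>b. sqrt (\<alpha> b) / S)"
  have S: "S > 0"
    unfolding S_def using \<alpha> by (intro sum_pos) auto
  have eq: "bin_objective \<alpha> \<nu> = S\<^sup>2 + (\<Sum>b\<in>UNIV. (sqrt (\<alpha> b) - S * \<nu> b)\<^sup>2 / \<nu> b)"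
    if "bin_masses \<nu>" for \<nu>
    unfolding S_def using bin_objective_eq[OF less_imp_le[OF \<alpha>] that] .
  have m: "bin_masses m"
    using S \<alpha> by (simp add: bin_masses_def m_def flip: sum_divide_distrib) (simp add: S_def)
  \<comment> \<open>Since \<open>S * m b = sqrt (\<alpha> b)\<close>, every remainder term
    vanishes.\<close>
  have obj_m: "bin_objective \<alpha> m = S\<^sup>2"
    using S by (simp add: eq[OF m]) (simp add: m_def)
  have lower: "bin_objective \<alpha> m \<le> bin_objective \<alpha> \<nu>" if \<nu>: "bin_masses \<nu>" for \<nu>
    using \<nu> by (simp add: obj_m eq[OF \<nu>] bin_masses_def sum_nonneg less_imp_le)
  have unique: "\<nu> = m" if \<nu>: "bin_masses \<nu>" and le: "bin_objective \<alpha> \<nu> \<le> bin_objective \<alpha> m" for \<nu>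
  proof
    fix b
    have pos: "\<nu> c > 0" for c
      using \<nu> by (simp add: bin_masses_def)
    then have nonneg: "(sqrt (\<alpha> c) - S * \<nu> c)\<^sup>2 / \<nu> c \<ge> 0" for c
      by (simp add: less_imp_le)
    \<comment> \<open>Being no worse than \<open>m\<close> bounds the remainder by zero from above,
      so each nonnegative term must vanish.\<close>
    have "(\<Sum>c\<in>UNIV. (sqrt (\<alpha> c) - S * \<nu> c)\<^sup>2 / \<nu> c) = 0"
      using le nonneg by (simp add: obj_m eq[OF \<nu>] order_antisym sum_nonneg)
    then have "(sqrt (\<alpha> b) - S * \<nu> b)\<^sup>2 / \<nu> b = 0"
      using nonneg by (simp add: sum_nonneg_eq_0_iff)
    then show "\<nu> b = m b"
      using pos[of b] S by (simp add: m_def field_simps)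
  qed
  \<comment> \<open>In a linear order a minimizer is a feasible point that is at most every feasible
    value; comparing with \<open>m\<close> alone identifies it.\<close>
  have "is_arg_min (bin_objective \<alpha>) bin_masses \<mu> \<longleftrightarrow> \<mu> = m"
    using m lower unique by (auto simp: is_arg_min_linorder)
  then show ?thesis
    by (simp add: m_def S_def)
qed

text \<open>The masses \<mu> are quantified after \<alpha>, so the difficulties stay fixed positive
  weights while \<mu> varies, and the preceding equivalence applies.\<close>

theorem proposition7p1:
  fixes M :: "'a measure"
    and x0 z :: "'a \<Rightarrow> real^'d"
    and \<sigma> :: "real \<Rightarrow> real"
    and T :: real
    and s :: "real^'p \<Rightarrow> real^'d \<Rightarrow> real \<Rightarrow> real^'d"
    and \<theta>star :: "real^'p"
    and V :: "real \<Rightarrow> real^'d \<Rightarrow> real^'d^'d"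
    and \<tau> :: "real measure"
    and I :: "'b::finite \<Rightarrow> real set"
    and tb :: "'b \<Rightarrow> real"
    and P H \<Gamma> :: "'b \<Rightarrow> real^'p^'p"
    and \<Delta> \<alpha> :: "'b \<Rightarrow> real"
  assumes "prob_space M"
    and "x0 \<in> borel_measurable M" and "integrable M x0"
    and "distributed M lborel z (\<lambda>x. ennreal (std_normal_vec_density x))"
    and "prob_space.indep_var M borel x0 borel z"
    \<comment> \<open>bins and representative times\<close>
    and "\<And>b. I b \<in> sets borel" and "disjoint_family I" and "(\<Union>b. I b) = {0..T}"
    and "\<And>b. \<Delta> b = measure lborel (I b)" and "\<And>b. \<Delta> b > 0"
    and "\<And>b. tb b \<in> I b"
    and "\<And>b. \<sigma> differentiable (at (tb b) within {0..T})"
    \<comment> \<open>time-sampling distribution\<close>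
    and "prob_space \<tau>" and "sets \<tau> = sets borel" and "AE t in \<tau>. t \<in> {0..T}"
    and "\<And>b. measure \<tau> (I b) > 0"
    \<comment> \<open>well-specified model\<close>
    and "\<exists>!\<theta>. denoises M x0 z \<sigma> T s \<theta>" and "denoises M x0 z \<sigma> T s \<theta>star"
    and "\<And>t x. t \<in> {0..T} \<Longrightarrow> (\<lambda>\<theta>. s \<theta> x t) differentiable (at \<theta>star)"
    and "\<And>t. t \<in> {0..T} \<Longrightarrow>
           cond_var_version M (noisy x0 z \<sigma> t)
             (\<lambda>\<omega>. x0 \<omega> - cond_mean M (noisy x0 z \<sigma> t) x0 \<omega>) (V t)"
    \<comment> \<open>binned orthogonality of time features\<close>
    and "binned_orthogonality I (param_jac s \<theta>star) P"
    \<comment> \<open>bin-conditioned operators\<close>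
    and "\<And>b. integrable (bin_sampling \<tau> (I b) M)
           (\<lambda>(t, \<omega>). param_gram s \<theta>star t (noisy x0 z \<sigma> t \<omega>))"
    and "\<And>b. H b = (\<integral>(t, \<omega>). param_gram s \<theta>star t (noisy x0 z \<sigma> t \<omega>)
           \<partial>(bin_sampling \<tau> (I b) M))"
    and "\<And>b. integrable (bin_sampling \<tau> (I b) M)
           (\<lambda>(t, \<omega>). noise_gram s \<theta>star V t (noisy x0 z \<sigma> t \<omega>))"
    and "\<And>b. \<Gamma> b = (\<integral>(t, \<omega>). noise_gram s \<theta>star V t (noisy x0 z \<sigma> t \<omega>)
           \<partial>(bin_sampling \<tau> (I b) M))"
    and "\<And>b. nondegenerate_on (im (P b)) (H b)"
    \<comment> \<open>bin difficulties\<close>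
    and "\<And>b. \<alpha> b = snr_rate T \<sigma> (tb b) * trace (inverse_on (P b) (H b) ** \<Gamma> b) * \<Delta> b"
    and "\<And>b. \<alpha> b > 0"
  shows "\<forall>\<mu>. is_arg_min (bin_objective \<alpha>) bin_masses \<mu> \<longleftrightarrow>
           \<mu> = (\<lambda>b. sqrt (\<alpha> b) / (\<Sum>j\<in>UNIV. sqrt (\<alpha> j)))"
  by (intro allI is_arg_min_bin_objective_iff) (rule \<open>\<And>b. \<alpha> b > 0\<close>)

end
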